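(* Let $D$ be an integral domain with quotient field $F$, and let $\mathcal{K}(D)$ be the ordered monoid of all nonzero $D$-submodules of $F$. The following conditions are equivalent for any self-map $\star: I \mapsto I^\star$ of $\mathcal{K}(D)$. (1) $\star$ is a semistar operation on $D$. (2) $\star$ is a nucleus on the ordered monoid $\mathcal{K}(D)$. (3) $\star$ is a closure operation on the poset $\mathcal{K}(D)$ and $\star$-multiplication on $\mathcal{K}(D)$ is associative. (4) $\star$ is a closure operation on the poset $\mathcal{K}(D)$ such that $(I^\star J^\star)^\star = (IJ)^\star$ for all $I,J \in \mathcal{K}(D)$ (or equivalently such that the map $\star: \mathcal{K}(D) \to \mathcal{K}(D)^\star$ is a magma homomorphism). (5) For all $H,I,J \in \mathcal{K}(D)$: $HJ \subseteq I^\star$ if and only if $HJ^\star \subseteq I^\star$. (6) $(I^\star :_F J) = (I^\star :_F J^\star)$ for all $I, J \in \mathcal{K}(D)$.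
   Context: $\mathcal{K}(D)$ is ordered by inclusion, and multiplication is the usual product of $D$-submodules ($IJ$ is the $D$-submodule generated by all products $xy$, $x\in I$, $y\in J$). A closure operation on a poset $S$ is a self-map $\star$ of $S$ that is expansive ($x \le x^\star$), order-preserving and idempotent. A semistar operation on $D$ is a closure operation $\star$ on the poset $\mathcal{K}(D)$ such that $(aI)^\star = aI^\star$ for all nonzero $a \in F$ and all $I \in \mathcal{K}(D)$. An ordered magma is a set $M$ with a binary operation (written multiplicatively) and a partial order such that $x\le x'$, $y \le y'$ imply $xy \le x'y'$; an ordered monoid is an ordered magma that is a monoid. A nucleus on an ordered magma $M$ is a closure operation $\star$ on $M$ with $x^\star y^\star \le (xy)^\star$ for all $x,y \in M$. For a self-map $\star$ of a magma $M$, $\star$-multiplication is the binary operation $(x,y)\mapsto (xy)^\star$ on $M$, and $M^\star$ denotes the image of $\star$, regarded as a magma under the restriction of $\star$-multiplication. For $D$-submodules $I,J$ of $F$, $(I:_F J) = \{x \in F : xJ \subseteq I\}$. *)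

theory Defs
  imports "HOL-Computational_Algebra.Polynomial_Factorial"
begin

section \<open>Closure operations, ordered magmas and nuclei\<close>

definition closure_operation :: "('m::order \<Rightarrow> 'm) \<Rightarrow> bool" where
  "closure_operation star \<longleftrightarrow> (\<forall>x. x \<le> star x) \<and> mono star \<and> (\<forall>x. star (star x) = star x)"

class ordered_magma = times + order +
  assumes magma_mult_mono: "x \<le> x' \<Longrightarrow> y \<le> y' \<Longrightarrow> x * y \<le> x' * y'"

class ordered_monoid = ordered_magma + monoid_mult

definition nucleus :: "('m::ordered_magma \<Rightarrow> 'm) \<Rightarrow> bool" where
  "nucleus star \<longleftrightarrow> closure_operation star \<and> (\<forall>x y. star x * star y \<le> star (x * y))"

definition star_mult :: "('m::times \<Rightarrow> 'm) \<Rightarrow> 'm \<Rightarrow> 'm \<Rightarrow> 'm" where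
  "star_mult star x y = star (x * y)"

definition magma_hom ::
  "'m set \<Rightarrow> ('m \<Rightarrow> 'm \<Rightarrow> 'm) \<Rightarrow> 'n set \<Rightarrow> ('n \<Rightarrow> 'n \<Rightarrow> 'n) \<Rightarrow> ('m \<Rightarrow> 'n) \<Rightarrow> bool" where
  "magma_hom A f B g h \<longleftrightarrow> h ` A \<subseteq> B \<and> (\<forall>x\<in>A. \<forall>y\<in>A. h (f x y) = g (h x) (h y))"


section \<open>Nonzero submodules of the quotient field\<close>

text \<open>
  The integral domain \<open>D\<close> is the type \<open>'a :: idom\<close> and its quotient field \<open>F\<close> is the type
  \<open>'a fract\<close>. In the locale \<^locale>\<open>module\<close> the submodules are called \<open>subspace\<close>, and
  \<open>span\<close> is the submodule generated by a set.
\<close>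

definition dscale :: "'a::idom \<Rightarrow> 'a fract \<Rightarrow> 'a fract" where
  "dscale d x = to_fract d * x"

global_interpretation dmod: module "dscale :: 'a::idom \<Rightarrow> 'a fract \<Rightarrow> 'a fract"
  by standard (simp_all add: dscale_def algebra_simps)

typedef (overloaded) ('a::idom) nzsubmod =
  "{I :: 'a fract set. dmod.subspace I \<and> I \<noteq> {0}}"
  morphisms elems Abs_nzsubmod
proof -
  have "(1 :: 'a fract) \<noteq> 0" by simp
  hence "(UNIV :: 'a fract set) \<noteq> {0}" by blast
  with dmod.subspace_UNIV show ?thesis by blast
qed

lemma subspace_elems: "dmod.subspace (elems I)"
  using elems[of I] by blast

lemma elems_nonzero: "\<exists>x\<in>elems I. x \<noteq> 0"
  using elems[of I] dmod.subspace_0[OF subspace_elems[of I]] by blast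

definition mult_set :: "'a::idom fract set \<Rightarrow> 'a fract set \<Rightarrow> 'a fract set" where
  "mult_set I J = dmod.span {x * y |x y. x \<in> I \<and> y \<in> J}"

lemma mult_set_base: "x \<in> I \<Longrightarrow> y \<in> J \<Longrightarrow> x * y \<in> mult_set I J"
  unfolding mult_set_def by (rule dmod.span_base) blast

lemma mult_set_least:
  assumes "dmod.subspace K" "\<And>x y. x \<in> I \<Longrightarrow> y \<in> J \<Longrightarrow> x * y \<in> K"
  shows "mult_set I J \<subseteq> K"
  unfolding mult_set_def using assms by (intro dmod.span_minimal) auto

lemma subspace_mult_set: "dmod.subspace (mult_set I J)"
  unfolding mult_set_def by (rule dmod.subspace_span)

lemma subspace_quotient:
  assumes "dmod.subspace K"
  shows "dmod.subspace {x. \<forall>y\<in>J. x * y \<in> K}"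
proof -
  have "dscale c x * y = dscale c (x * y)" for c and x y :: "'a fract"
    by (simp add: dscale_def mult.assoc)
  with assms show ?thesis by (auto simp: dmod.subspace_def distrib_right)
qed

lemma mult_set_commute: "mult_set I J = mult_set J I"
proof -
  have "{x * y |x y. x \<in> I \<and> y \<in> J} = {x * y |x y. x \<in> J \<and> y \<in> I}"
    by (metis (no_types, opaque_lifting) mult.commute)
  thus ?thesis by (simp only: mult_set_def)
qed

lemma mult_set_assoc_le: "mult_set (mult_set H I) J \<subseteq> mult_set H (mult_set I J)"
proof (rule mult_set_least[OF subspace_mult_set])
  fix x y assume x: "x \<in> mult_set H I" and y: "y \<in> J"
  have "mult_set H I \<subseteq> {x. \<forall>y\<in>J. x * y \<in> mult_set H (mult_set I J)}"
    by (rule mult_set_least[OF subspace_quotient[OF subspace_mult_set]])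
      (auto simp: mult.assoc intro!: mult_set_base)
  with x y show "x * y \<in> mult_set H (mult_set I J)" by blast
qed

lemma mult_set_assoc: "mult_set (mult_set H I) J = mult_set H (mult_set I J)"
proof
  show "mult_set (mult_set H I) J \<subseteq> mult_set H (mult_set I J)"
    by (rule mult_set_assoc_le)
  have "mult_set H (mult_set I J) = mult_set (mult_set J I) H"
    by (metis mult_set_commute)
  also have "\<dots> \<subseteq> mult_set J (mult_set I H)"
    by (rule mult_set_assoc_le)
  also have "\<dots> = mult_set (mult_set H I) J"
    by (metis mult_set_commute)
  finally show "mult_set H (mult_set I J) \<subseteq> mult_set (mult_set H I) J" .
qed

lemma subspace_range_to_fract: "dmod.subspace (range (to_fract :: 'a::idom \<Rightarrow> 'a fract))"
proof -
  have "range to_fract = dmod.span {1 :: 'a fract}"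
    by (simp add: dmod.span_singleton dscale_def)
  thus ?thesis by simp
qed

lemma mult_set_one:
  fixes I :: "'a::idom fract set"
  assumes "dmod.subspace I"
  shows "mult_set (range to_fract) I = I"
proof
  show "mult_set (range to_fract) I \<subseteq> I"
  proof (rule mult_set_least[OF assms])
    fix x y :: "'a fract" assume "x \<in> range to_fract" and y: "y \<in> I"
    then obtain d where "x * y = dscale d y" by (auto simp: dscale_def)
    with dmod.subspace_scale[OF assms y, of d] show "x * y \<in> I" by simp
  qed
  show "I \<subseteq> mult_set (range to_fract) I"
  proof
    fix x assume x: "x \<in> I"
    have "1 \<in> range (to_fract :: 'a \<Rightarrow> 'a fract)" by (rule range_eqI[of _ _ 1]) simp
    from mult_set_base[OF this x] show "x \<in> mult_set (range to_fract) I"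
      by (simp only: mult_1_left)
  qed
qed

instantiation nzsubmod :: (idom) order
begin

definition less_eq_nzsubmod :: "'a nzsubmod \<Rightarrow> 'a nzsubmod \<Rightarrow> bool" where
  "I \<le> J \<longleftrightarrow> elems I \<subseteq> elems J"

definition less_nzsubmod :: "'a nzsubmod \<Rightarrow> 'a nzsubmod \<Rightarrow> bool" where
  "I < J \<longleftrightarrow> elems I \<subset> elems J"

instance
  by standard (auto simp: less_eq_nzsubmod_def less_nzsubmod_def elems_inject)

end

instantiation nzsubmod :: (idom) "{one, times}"
begin

definition one_nzsubmod :: "'a nzsubmod" where
  "1 = Abs_nzsubmod (range to_fract)"

definition times_nzsubmod :: "'a nzsubmod \<Rightarrow> 'a nzsubmod \<Rightarrow> 'a nzsubmod" where
  "I * J = Abs_nzsubmod (mult_set (elems I) (elems J))"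

instance ..

end

lemma elems_one: "elems (1 :: 'a::idom nzsubmod) = range to_fract"
proof -
  have "(1 :: 'a fract) \<in> range to_fract" by (rule range_eqI[of _ _ 1]) simp
  hence "range to_fract \<noteq> {0 :: 'a fract}" by (metis singletonD zero_neq_one)
  thus ?thesis
    unfolding one_nzsubmod_def using subspace_range_to_fract
    by (intro Abs_nzsubmod_inverse CollectI conjI)
qed

lemma elems_mult: "elems (I * J) = mult_set (elems I) (elems J)"
proof -
  obtain x y where "x \<in> elems I" "x \<noteq> 0" "y \<in> elems J" "y \<noteq> 0"
    using elems_nonzero by metis
  hence "x * y \<in> mult_set (elems I) (elems J)" "x * y \<noteq> 0"
    by (auto intro: mult_set_base)
  hence "mult_set (elems I) (elems J) \<noteq> {0}" by blast
  thus ?thesis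
    unfolding times_nzsubmod_def by (simp add: Abs_nzsubmod_inverse subspace_mult_set)
qed

instance nzsubmod :: (idom) ordered_monoid
proof
  fix I I' J J' K :: "'a nzsubmod"
  show "I * J * K = I * (J * K)"
    by (rule elems_inject[THEN iffD1]) (simp only: elems_mult mult_set_assoc)
  show "1 * I = I"
    by (rule elems_inject[THEN iffD1])
      (simp only: elems_mult elems_one mult_set_one[OF subspace_elems])
  thus "I * 1 = I"
    by (metis elems_inject elems_mult mult_set_commute)
  show "I * J \<le> I' * J'" if "I \<le> I'" "J \<le> J'"
    unfolding less_eq_nzsubmod_def elems_mult
  proof (rule mult_set_least[OF subspace_mult_set])
    fix x y assume "x \<in> elems I" "y \<in> elems J"
    with that show "x * y \<in> mult_set (elems I') (elems J')"
      by (intro mult_set_base) (auto simp: less_eq_nzsubmod_def)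
  qed
qed

text \<open>The submodule \<open>aI\<close>; meaningful only for \<open>a \<noteq> 0\<close>, since \<open>0I\<close> is not a nonzero submodule.\<close>

definition dilate :: "'a::idom fract \<Rightarrow> 'a nzsubmod \<Rightarrow> 'a nzsubmod" where
  "dilate a I = Abs_nzsubmod ((\<lambda>x. a * x) ` elems I)"

lemma elems_dilate:
  assumes "a \<noteq> 0"
  shows "elems (dilate a I) = (\<lambda>x. a * x) ` elems I"
proof -
  have "(\<lambda>x. a * x) ` elems I = {z. \<forall>y\<in>{inverse a}. z * y \<in> elems I}"
  proof (intro set_eqI iffI)
    fix z assume "z \<in> (\<lambda>x. a * x) ` elems I"
    then obtain x where x: "x \<in> elems I" "z = a * x" by blast
    have "z * inverse a = (a * inverse a) * x" by (simp only: x(2) ac_simps)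
    also have "\<dots> = x" by (simp only: right_inverse[OF assms] mult_1_left)
    finally have "z * inverse a = x" .
    with x(1) show "z \<in> {z. \<forall>y\<in>{inverse a}. z * y \<in> elems I}" by simp
  next
    fix z assume "z \<in> {z. \<forall>y\<in>{inverse a}. z * y \<in> elems I}"
    hence "z * inverse a \<in> elems I" by simp
    moreover have "a * (z * inverse a) = (a * inverse a) * z" by (simp only: ac_simps)
    hence "z = a * (z * inverse a)" by (simp only: right_inverse[OF assms] mult_1_left)
    ultimately show "z \<in> (\<lambda>x. a * x) ` elems I" by (rule rev_image_eqI)
  qed
  hence "dmod.subspace ((\<lambda>x. a * x) ` elems I)"
    by (simp only: subspace_quotient[OF subspace_elems])
  moreover obtain x where "x \<in> elems I" "x \<noteq> 0" using elems_nonzero by blast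
  hence "a * x \<in> (\<lambda>x. a * x) ` elems I" "a * x \<noteq> 0" using assms by simp_all
  hence "(\<lambda>x. a * x) ` elems I \<noteq> {0}" by (metis singletonD)
  ultimately show ?thesis
    unfolding dilate_def by (intro Abs_nzsubmod_inverse CollectI conjI)
qed

definition semistar_operation :: "('a::idom nzsubmod \<Rightarrow> 'a nzsubmod) \<Rightarrow> bool" where
  "semistar_operation star \<longleftrightarrow>
     closure_operation star \<and> (\<forall>a I. a \<noteq> 0 \<longrightarrow> star (dilate a I) = dilate a (star I))"

text \<open>The residual \<open>(I :\<^sub>F J)\<close> is a plain subset of \<open>F\<close>, because it can be zero.\<close>

definition colon :: "'a::idom nzsubmod \<Rightarrow> 'a nzsubmod \<Rightarrow> 'a fract set" where
  "colon I J = {x. (\<lambda>y. x * y) ` elems J \<subseteq> elems I}"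

end

(*
Semistar operations are tied to the other conditions through the principal submodules aD, which
are units of the monoid K(D): a nucleus commutes with multiplication by any unit. Conversely, if
star commutes with all dilations, then xJ is contained in the closed module I* exactly when xJ* is,
for each single x; this is (6). Taking all x in H gives (5), and the instance H = 1 of (5) says that
star is a closure operation, while two uses of (5) move the star past both factors of a product.
*)

theory Submission
  imports Defs
begin

lemma closure_operation_le_iff:
  assumes "closure_operation star"
  shows "x \<le> star y \<longleftrightarrow> star x \<le> star y"
  using assms unfolding closure_operation_def by (metis monoD order_trans)

text \<open>The case \<open>y = x\<close> gives both halves: read backwards, \<open>star x\<close>
  \<le> \<open>star x\<close> yields expansiveness; read forwards at the point
  \<open>star x\<close>, it yields idempotence. Monotonicity follows since \<open>x\<close> \<le>
  \<open>y\<close> \<le> \<open>star y\<close>.\<close>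

lemma closure_operationI:
  assumes "\<And>x y. x \<le> star y \<longleftrightarrow> star x \<le> star y"
  shows "closure_operation star"
  unfolding closure_operation_def
  by (intro conjI allI monoI) (meson assms order_refl order_trans order_antisym)+

text \<open>For any closure operation, \<open>x * y\<close> \<le> \<open>star x * star y\<close>
  already gives one inequality of the equation. The other one is the nucleus inequality, because an
  element lies below the closed \<open>star (x * y)\<close> exactly when its closure does.\<close>

lemma nucleus_iff_star_mult_hom:
  fixes star :: "'m::ordered_magma \<Rightarrow> 'm"
  shows "nucleus star \<longleftrightarrow> closure_operation star \<and> (\<forall>x y. star (star x * star y) = star (x * y))"
proof -
  have "star x * star y \<le> star (x * y) \<longleftrightarrow> star (star x * star y) = star (x * y)"
    if cl: "closure_operation star" for x y
  proof -
    have "x * y \<le> star x * star y"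
      using cl by (simp add: closure_operation_def magma_mult_mono)
    hence "star (x * y) \<le> star (star x * star y)"
      using cl by (simp add: closure_operation_def monoD)
    thus ?thesis
      using closure_operation_le_iff[OF cl] by (metis order_antisym order_refl)
  qed
  thus ?thesis by (auto simp: nucleus_def)
qed

lemma nucleus_iff_star_mult_assoc:
  fixes star :: "'m::ordered_monoid \<Rightarrow> 'm"
  shows "nucleus star \<longleftrightarrow> closure_operation star \<and> semigroup (star_mult star)"
proof (cases "closure_operation star")
  case True
  hence idem: "star (star x) = star x" for x by (simp add: closure_operation_def)
  show ?thesis
  proof
    assume "nucleus star"
    hence hom: "star (star x * star y) = star (x * y)" for x y
      by (simp add: nucleus_iff_star_mult_hom)
    have "star (star (x * y) * z) = star (x * star (y * z))" for x y z
      by (metis hom idem mult.assoc)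
    with True show "closure_operation star \<and> semigroup (star_mult star)"
      by (simp add: semigroup_def star_mult_def)
  next
    assume "closure_operation star \<and> semigroup (star_mult star)"
    hence assoc: "star (star (x * y) * z) = star (x * star (y * z))" for x y z
      by (simp add: semigroup_def star_mult_def)
    have left: "star (star x * y) = star (x * y)" for x y
      using assoc[of 1 x y] by (simp add: idem)
    have right: "star (x * star y) = star (x * y)" for x y
      using assoc[of x y 1] by (simp add: idem)
    show "nucleus star"
      by (simp add: nucleus_iff_star_mult_hom True left right)
  qed
qed (simp add: nucleus_def)

text \<open>Multiplication by any \<open>w\<close> satisfies \<open>w * star y\<close> \<le>
  \<open>star (w * y)\<close>, since \<open>w\<close> \<le> \<open>star w\<close>. For a unit the
  reverse inequality comes from the same fact for its inverse.\<close>

lemma nucleus_mult_unit: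
  fixes star :: "'m::ordered_monoid \<Rightarrow> 'm"
  assumes "nucleus star" "u * v = 1" "v * u = 1"
  shows "star (u * x) = u * star x"
proof -
  have cl: "closure_operation star" and nuc: "star y * star z \<le> star (y * z)" for y z
    using assms(1) by (auto simp: nucleus_def)
  have le: "w * star y \<le> star (w * y)" for w y
    using cl nuc by (metis closure_operation_def magma_mult_mono order_refl order_trans)
  \<comment> \<open>Multiplying by \<open>u\<close> cancels \<open>v\<close> on the left;
    \<open>v * u = 1\<close> cancels inside the star on the right.\<close>
  have "u * (v * star (u * x)) \<le> u * star (v * (u * x))"
    by (intro magma_mult_mono le order_refl)
  hence "star (u * x) \<le> u * star x"
    by (simp add: assms mult.assoc[symmetric])
  with le show ?thesis by (intro order_antisym)
qed

lemma nzsubmod_eqI: "elems I = elems J \<Longrightarrow> I = J"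
  by (simp add: elems_inject)

lemma nzsubmod_mult_commute: "I * J = J * (I :: 'a::idom nzsubmod)"
  by (rule nzsubmod_eqI) (simp add: elems_mult mult_set_commute)

lemma mult_le_iff: "I * J \<le> K \<longleftrightarrow> (\<forall>x\<in>elems I. \<forall>y\<in>elems J. x * y \<in> elems K)"
  unfolding less_eq_nzsubmod_def elems_mult
  using mult_set_least[OF subspace_elems[of K], of "elems I" "elems J"] mult_set_base by blast

text \<open>This is residuation: the products with \<open>J\<close> that lie below \<open>K\<close>
  depend on \<open>J\<close> only through \<open>colon K J\<close>, so equal colons give equivalent
  inclusions.\<close>

lemma mult_le_iff_colon: "I * J \<le> K \<longleftrightarrow> elems I \<subseteq> colon K J"
  by (auto simp: mult_le_iff colon_def)

lemma dilate_dilate: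
  assumes "a \<noteq> 0" "b \<noteq> 0"
  shows "dilate a (dilate b I) = dilate (a * b) I"
  by (rule nzsubmod_eqI) (simp add: assms elems_dilate image_image mult.assoc)

lemma dilate_one: "dilate 1 I = I"
  by (rule nzsubmod_eqI) (simp add: elems_dilate)

lemma dilate_mult_le:
  assumes "a \<noteq> 0"
  shows "dilate a I * J \<le> dilate a (I * J)"
  by (auto simp: mult_le_iff elems_dilate[OF assms] elems_mult mult.assoc mult_set_base)

lemma dilate_mono:
  assumes "a \<noteq> 0" "I \<le> J"
  shows "dilate a I \<le> dilate a J"
  using assms by (auto simp: less_eq_nzsubmod_def elems_dilate)

lemma dilate_mult:
  assumes "a \<noteq> 0"
  shows "dilate a I * J = dilate a (I * J)"
proof (rule order_antisym[OF dilate_mult_le[OF assms]])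
  have inv: "inverse a \<noteq> 0" "a * inverse a = 1" "inverse a * a = 1"
    using assms by (auto simp: right_inverse left_inverse)
  \<comment> \<open>The inclusion already known, used for \<open>inverse a\<close> and the dilated
    module, becomes the missing one after dilating back by \<open>a\<close>.\<close>
  have "dilate (inverse a) (dilate a I * J) \<ge> dilate (inverse a) (dilate a I) * J"
    by (rule dilate_mult_le[OF inv(1)])
  hence "I * J \<le> dilate (inverse a) (dilate a I * J)"
    by (simp only: dilate_dilate[OF inv(1) assms] inv dilate_one)
  from dilate_mono[OF assms this] show "dilate a (I * J) \<le> dilate a I * J"
    by (simp only: dilate_dilate[OF assms inv(1)] inv dilate_one)
qed

lemma nucleus_imp_semistar:
  assumes "nucleus star"
  shows "semistar_operation star"
  unfolding semistar_operation_def
proof (intro conjI allI impI)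
  show "closure_operation star" using assms by (simp add: nucleus_def)
  fix a :: "'a fract" and I assume a: "a \<noteq> 0"
  have inv: "inverse a \<noteq> 0" "a * inverse a = 1" "inverse a * a = 1"
    using a by (auto simp: right_inverse left_inverse)
  \<comment> \<open>\<open>dilate a 1\<close> is the principal module aD, so dilation is
    multiplication by a unit of the monoid.\<close>
  have principal: "dilate a J = dilate a 1 * J" for J
    using dilate_mult[OF a, of 1 J] by simp
  have "dilate a 1 * dilate (inverse a) 1 = 1" "dilate (inverse a) 1 * dilate a 1 = 1"
    by (simp_all only: dilate_mult[OF a] dilate_mult[OF inv(1)] mult_1_left
        dilate_dilate[OF a inv(1)] dilate_dilate[OF inv(1) a] inv dilate_one)
  from nucleus_mult_unit[OF assms this] show "star (dilate a I) = dilate a (star I)"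
    by (metis principal)
qed

lemma mem_colon_iff_dilate:
  assumes "x \<noteq> 0"
  shows "x \<in> colon I J \<longleftrightarrow> dilate x J \<le> I"
  by (simp add: colon_def less_eq_nzsubmod_def elems_dilate[OF assms])

lemma zero_mem_colon: "0 \<in> colon I J"
  using dmod.subspace_0[OF subspace_elems] by (auto simp: colon_def)

lemma semistar_imp_colon:
  assumes "semistar_operation star"
  shows "colon (star I) J = colon (star I) (star J)"
proof (rule set_eqI)
  fix x
  show "x \<in> colon (star I) J \<longleftrightarrow> x \<in> colon (star I) (star J)"
  \<comment> \<open>Dilation is meaningful only for nonzero \<open>x\<close>; zero lies in every
    colon.\<close>
  proof (cases "x = 0")
    case False
    have "closure_operation star" "dilate x (star J) = star (dilate x J)"
      using assms False by (simp_all add: semistar_operation_def)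
    thus ?thesis
      by (simp add: mem_colon_iff_dilate[OF False] closure_operation_le_iff[of star "dilate x J"])
  qed (simp add: zero_mem_colon)
qed

lemma nucleusI_residuation:
  fixes star :: "'a::idom nzsubmod \<Rightarrow> 'a nzsubmod"
  assumes res: "\<And>H I J. H * J \<le> star I \<longleftrightarrow> H * star J \<le> star I"
  shows "nucleus star"
  unfolding nucleus_def
proof (intro conjI allI)
  show cl: "closure_operation star"
    using res[of 1] unfolding mult_1_left by (rule closure_operationI)
  fix I J
  have "I * J \<le> star (I * J)" using cl by (simp add: closure_operation_def)
  \<comment> \<open>The equivalence moves the star only past the right factor, so commutativity
    swaps the factors before its second use.\<close>
  hence "star J * I \<le> star (I * J)" by (metis res nzsubmod_mult_commute)
  thus "star I * star J \<le> star (I * J)"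
    by (metis res nzsubmod_mult_commute)
qed

theorem theorem1p2:
  fixes star :: "'a::idom nzsubmod \<Rightarrow> 'a nzsubmod"
  shows "(semistar_operation star \<longleftrightarrow> nucleus star)
    \<and> (semistar_operation star \<longleftrightarrow>
         closure_operation star \<and> semigroup (star_mult star))
    \<and> (semistar_operation star \<longleftrightarrow>
         closure_operation star \<and> (\<forall>I J. star (star I * star J) = star (I * J)))
    \<and> (semistar_operation star \<longleftrightarrow>
         closure_operation star \<and> magma_hom UNIV (*) (range star) (star_mult star) star)
    \<and> (semistar_operation star \<longleftrightarrow>
         (\<forall>H I J. H * J \<le> star I \<longleftrightarrow> H * star J \<le> star I))
    \<and> (semistar_operation star \<longleftrightarrow>
         (\<forall>I J. colon (star I) J = colon (star I) (star J)))"
proof -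
  let ?hom = "\<forall>I J. star (star I * star J) = star (I * J)"
  let ?res = "\<forall>H I J. H * J \<le> star I \<longleftrightarrow> H * star J \<le> star I"
  let ?col = "\<forall>I J. colon (star I) J = colon (star I) (star J)"
  have 16: "semistar_operation star \<Longrightarrow> ?col"
    using semistar_imp_colon by blast
  have 65: "?col \<Longrightarrow> ?res"
    by (simp add: mult_le_iff_colon)
  have 52: "?res \<Longrightarrow> nucleus star"
    by (rule nucleusI_residuation) blast
  have 21: "nucleus star \<Longrightarrow> semistar_operation star"
    by (rule nucleus_imp_semistar)
  \<comment> \<open>On the image, the star-product of \<open>star I\<close> and
    \<open>star J\<close> is \<open>star (star I * star J)\<close> by definition. The four
    implications above form a cycle through the nucleus condition, to which the remaining conditions
    attach.\<close>
  have "magma_hom UNIV (*) (range star) (star_mult star) star \<longleftrightarrow> ?hom"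
    by (auto simp: magma_hom_def star_mult_def)
  with 16 65 52 21 nucleus_iff_star_mult_assoc[of star] nucleus_iff_star_mult_hom[of star]
  show ?thesis by argo
qed

end
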